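(* Let $\mathcal H$ be an $l$-uniform hypergraph with $n$ vertices and $t$ edges which is nearly-disjoint, i.e. any two distinct edges share at most one vertex. Let $m\le t$ and let $\mathcal M=\{e_1,\dots,e_m\}$ be a uniformly random $m$-subset of $\mathcal H$. If $t\gg n/l$ and $c=\min\{ml^2/n,\ tl/n\}$, then \[ \Pr(\mathcal M\text{ is a matching})<\begin{cases}\exp[-\Omega(cm)] & \text{if } c\le e,\\ \exp[-\Omega((\log c)m)] & \text{if } c>e.\end{cases} \]
   Context: A matching is a collection of pairwise disjoint sets. Asymptotic notation refers to $n\to\infty$ ($t\gg n/l$ means $n/l=o(t)$), with implied constants in $\Omega(\cdot)$ absolute (independent of $\mathcal H$, $l$, $t$, $m$); $n$ is assumed sufficiently large. $\log$ is the natural logarithm.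
   Formalization: The hypothesis m ≥ 2 is added: for m = 0 the claim reads 1 < 1, and for m = 1 a single edge is always a matching, so the probability is 1 while the right-hand side is below 1 (for example, projective planes with n = t = q²+q+1, l = q+1). *)

theory Defs
  imports "HOL-Probability.Probability" "HOL-Library.Landau_Symbols" "HOL-Library.Disjoint_Sets"
begin

definition uniform_hypergraph :: "nat \<Rightarrow> 'a set \<Rightarrow> 'a set set \<Rightarrow> bool" where
  "uniform_hypergraph l V H \<longleftrightarrow> finite V \<and> (\<forall>e\<in>H. e \<subseteq> V \<and> card e = l)"

definition nearly_disjoint :: "'a set set \<Rightarrow> bool" where
  "nearly_disjoint H \<longleftrightarrow> (\<forall>e\<in>H. \<forall>f\<in>H. e \<noteq> f \<longrightarrow> card (e \<inter> f) \<le> 1)"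

definition is_matching :: "'a set set \<Rightarrow> bool" where
  "is_matching M \<longleftrightarrow> disjoint M"

(* Only meaningful for finite H with m <= card H; otherwise pmf_of_set is applied to an
   empty or infinite set and is unspecified. *)
definition random_subset :: "nat \<Rightarrow> 'b set \<Rightarrow> 'b set pmf" where
  "random_subset m H = pmf_of_set {M. M \<subseteq> H \<and> card M = m}"

end

theory Submission
  imports Defs
begin

text \<open>Choose the edges one at a time and let \<open>R\<close> be the set of edges disjoint from all earlier
  choices. By Cauchy--Schwarz, as long as \<open>R\<close> is not too small, all but a fraction \<open>p\<close> of its edges
  have large degree sum in \<open>R\<close>; by near-disjointness choosing such an edge deletes about
  \<open>p |R| l\<^sup>2 / n\<close> edges from \<open>R\<close>. Hence, for a matching, either most choices fall into the exceptional
  fraction \<open>p\<close>, or \<open>R\<close> shrinks quickly and makes the later choices unlikely. Counting matchings by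
  induction turns this into a product of factors \<open>p + (1 - p) exp (- j \<eta>)\<close>, where \<open>\<eta>\<close> has order
  \<open>p\<^sup>2 l\<^sup>2 / n\<close>. The choice \<open>p = 1/2\<close> works for bounded \<open>c\<close>, and \<open>p = c\<close> to the power \<open>-1/4\<close>
  for large \<open>c\<close>.\<close>

section \<open>Matchings and the edges that avoid a given edge\<close>

definition matchings :: "'a set set \<Rightarrow> nat \<Rightarrow> 'a set set set" where
  "matchings R s = {M. M \<subseteq> R \<and> card M = s \<and> disjoint M}"

definition edges_avoiding :: "'a set set \<Rightarrow> 'a set \<Rightarrow> 'a set set" where
  "edges_avoiding R e = {f \<in> R. f \<inter> e = {}}"

lemma finite_matchings: "finite R \<Longrightarrow> finite (matchings R s)"
  by (rule finite_subset[of _ "Pow R"]) (auto simp: matchings_def)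

lemma finite_edges_avoiding: "finite R \<Longrightarrow> finite (edges_avoiding R e)"
  by (simp add: edges_avoiding_def)

lemma edges_avoiding_subset: "edges_avoiding R e \<subseteq> R"
  by (auto simp: edges_avoiding_def)

lemma uniform_hypergraph_subset:
  "uniform_hypergraph l V H \<Longrightarrow> R \<subseteq> H \<Longrightarrow> uniform_hypergraph l V R"
  by (auto simp: uniform_hypergraph_def)

lemma nearly_disjoint_subset: "nearly_disjoint H \<Longrightarrow> R \<subseteq> H \<Longrightarrow> nearly_disjoint R"
  by (auto simp: nearly_disjoint_def)

lemma uniform_hypergraph_finite: "uniform_hypergraph l V H \<Longrightarrow> finite H"
  by (rule finite_subset[of _ "Pow V"]) (auto simp: uniform_hypergraph_def)

lemma uniform_hypergraph_finite_edge: "uniform_hypergraph l V H \<Longrightarrow> e \<in> H \<Longrightarrow> finite e"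
  by (meson finite_subset uniform_hypergraph_def)

text \<open>Double counting of pairs \<open>(M, e)\<close> with \<open>e\<close> in
  \<open>M\<close>: deleting \<open>e\<close> leaves a matching of size \<open>s\<close> among the
  edges avoiding \<open>e\<close>, and the pair \<open>(e, M - {e})\<close> determines
  \<open>M\<close>.\<close>

lemma card_matchings_Suc:
  assumes fin: "finite R"
  shows "Suc s * card (matchings R (Suc s)) \<le> (\<Sum>e\<in>R. card (matchings (edges_avoiding R e) s))"
proof -
  let ?A = "SIGMA M:matchings R (Suc s). M"
  let ?B = "SIGMA e:R. matchings (edges_avoiding R e) s"
  let ?\<phi> = "\<lambda>(M, e). (e, M - {e})"
  have finM: "finite M" if "M \<in> matchings R k" for M k
    using that fin finite_subset by (auto simp: matchings_def)
  have "card ?A = (\<Sum>M\<in>matchings R (Suc s). card M)"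
    using finite_matchings[OF fin] finM by (intro card_SigmaI) auto
  also have "\<dots> = (\<Sum>M\<in>matchings R (Suc s). Suc s)"
    by (rule sum.cong) (auto simp: matchings_def)
  finally have A: "card ?A = Suc s * card (matchings R (Suc s))" by simp
  have finB: "finite ?B"
    using fin finite_matchings finite_edges_avoiding by (intro finite_SigmaI) blast+
  have B: "card ?B = (\<Sum>e\<in>R. card (matchings (edges_avoiding R e) s))"
    using fin finite_matchings finite_edges_avoiding by (intro card_SigmaI) blast+
  have inj: "inj_on ?\<phi> ?A"
    by (auto simp: inj_on_def)
  have "?\<phi> ` ?A \<subseteq> ?B"
  proof clarsimp
    fix M e assume M: "M \<in> matchings R (Suc s)" and e: "e \<in> M"
    have "M - {e} \<subseteq> edges_avoiding R e"
      using M e by (auto simp: matchings_def edges_avoiding_def disjoint_def)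
    moreover have "card (M - {e}) = s"
      using M e finM[OF M] by (simp add: matchings_def)
    moreover have "disjoint (M - {e})"
      using M by (auto simp: matchings_def disjoint_def)
    ultimately show "e \<in> R \<and> M - {e} \<in> matchings (edges_avoiding R e) s"
      using M e by (auto simp: matchings_def)
  qed
  from card_inj_on_le[OF inj this finB] show ?thesis
    by (simp add: A B)
qed

section \<open>Degree sums and the number of edges deleted by one choice\<close>

text \<open>Let \<open>d v\<close> be the degree of \<open>v\<close> in \<open>B\<close>. The
  degrees add up to \<open>l * card B\<close>, their squares add up to the sum of all intersection
  sizes, and Cauchy-Schwarz against the constant 1 compares the two.\<close>

lemma sum_card_inter_ge:
  assumes "uniform_hypergraph l V B"
  shows "real ((l * card B)\<^sup>2) \<le> real (card V) * (\<Sum>e\<in>B. \<Sum>f\<in>B. real (card (e \<inter> f)))"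
proof -
  define i :: "'a set \<Rightarrow> 'a \<Rightarrow> real" where "i e v = (if v \<in> e then 1 else 0)" for e v
  define d where "d v = (\<Sum>e\<in>B. i e v)" for v
  have V: "finite V" and sub: "\<And>e. e \<in> B \<Longrightarrow> e \<subseteq> V" and l: "\<And>e. e \<in> B \<Longrightarrow> card e = l"
    using assms by (auto simp: uniform_hypergraph_def)
  have ii: "(\<Sum>v\<in>V. i e v * i f v) = real (card (e \<inter> f))" if "e \<in> B" for e f
  proof -
    have "(\<Sum>v\<in>V. i e v * i f v) = (\<Sum>v\<in>V. if v \<in> e \<inter> f then 1 else 0)"
      by (rule sum.cong) (auto simp: i_def)
    also have "\<dots> = real (card (V \<inter> (e \<inter> f)))"
      using V by (simp add: sum.If_cases Int_def)
    also have "V \<inter> (e \<inter> f) = e \<inter> f" using sub[OF that] by auto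
    finally show ?thesis .
  qed
  have "(\<Sum>v\<in>V. d v) = (\<Sum>e\<in>B. \<Sum>v\<in>V. i e v)"
    unfolding d_def by (rule sum.swap)
  also have "\<dots> = (\<Sum>e\<in>B. real l)"
  proof (rule sum.cong)
    fix e assume e: "e \<in> B"
    have "(\<Sum>v\<in>V. i e v) = (\<Sum>v\<in>V. i e v * i e v)" by (rule sum.cong) (auto simp: i_def)
    then show "(\<Sum>v\<in>V. i e v) = real l" using ii[OF e, of e] l[OF e] by simp
  qed simp
  finally have d1: "(\<Sum>v\<in>V. d v) = real (l * card B)" by simp
  have "(\<Sum>v\<in>V. (d v)\<^sup>2) = (\<Sum>v\<in>V. \<Sum>e\<in>B. \<Sum>f\<in>B. i e v * i f v)"
    by (simp add: d_def power2_eq_square sum_product)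
  also have "\<dots> = (\<Sum>e\<in>B. \<Sum>v\<in>V. \<Sum>f\<in>B. i e v * i f v)"
    by (rule sum.swap)
  also have "\<dots> = (\<Sum>e\<in>B. \<Sum>f\<in>B. \<Sum>v\<in>V. i e v * i f v)"
    by (intro sum.cong refl sum.swap)
  also have "\<dots> = (\<Sum>e\<in>B. \<Sum>f\<in>B. real (card (e \<inter> f)))"
    by (intro sum.cong refl ii)
  finally have d2: "(\<Sum>v\<in>V. (d v)\<^sup>2) = \<dots>" .
  have "(\<Sum>v\<in>V. d v * 1)\<^sup>2 \<le> (\<Sum>v\<in>V. (d v)\<^sup>2) * (\<Sum>v\<in>V. 1\<^sup>2)"
    by (rule Cauchy_Schwarz_ineq_sum)
  then show ?thesis by (simp add: d1 d2 mult.commute)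
qed

text \<open>Cauchy-Schwarz is applied to the low edges alone. Their degree sums within this set are
  at most those within \<open>R\<close>, so the upper bound is linear in the size of the set while
  the lower bound is quadratic; cancelling leaves \<open>q\<close>.\<close>

lemma card_low_edges_le:
  assumes R: "uniform_hypergraph l V R" and l: "l > 0" and n: "card V > 0" and q: "q \<ge> 0"
  shows "real (card {e \<in> R. (\<Sum>f\<in>R. real (card (e \<inter> f))) < q * real l ^ 2 / real (card V)}) \<le> q"
    (is "real (card ?B) \<le> _")
proof (cases "?B = {}")
  case True
  then have "card ?B = 0" by (rule ssubst) simp
  then show ?thesis using q by simp
next
  case False
  have fin: "finite R" by (rule uniform_hypergraph_finite[OF R])
  then have b: "card ?B > 0" using False by (simp add: card_gt_0_iff)
  let ?n = "real (card V)"
  have "real ((l * card ?B)\<^sup>2) \<le> ?n * (\<Sum>e\<in>?B. \<Sum>f\<in>?B. real (card (e \<inter> f)))"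
    by (rule sum_card_inter_ge, rule uniform_hypergraph_subset[OF R]) auto
  also have "\<dots> \<le> ?n * (\<Sum>e\<in>?B. q * real l ^ 2 / ?n)"
  proof (intro mult_left_mono sum_mono)
    fix e assume e: "e \<in> ?B"
    have "(\<Sum>f\<in>?B. real (card (e \<inter> f))) \<le> (\<Sum>f\<in>R. real (card (e \<inter> f)))"
      using fin by (intro sum_mono2) auto
    then show "(\<Sum>f\<in>?B. real (card (e \<inter> f))) \<le> q * real l ^ 2 / ?n" using e by simp
  qed simp
  also have "\<dots> = real (card ?B) * real l ^ 2 * q" using n by simp
  finally have "(real (card ?B) * real l ^ 2) * real (card ?B) \<le> (real (card ?B) * real l ^ 2) * q"
    by (simp add: power2_eq_square mult_ac)
  then show ?thesis
    using b l by (subst (asm) mult_le_cancel_left_pos) auto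
qed

text \<open>Near-disjointness makes each \<open>f \<noteq> e\<close> contribute at most 1 to the sum,
  while \<open>e\<close> itself contributes \<open>l\<close>.\<close>

lemma card_edges_avoiding:
  assumes R: "uniform_hypergraph l V R" and nd: "nearly_disjoint R" and l: "l > 0" and e: "e \<in> R"
  shows "real (card (edges_avoiding R e)) + 1 + ((\<Sum>f\<in>R. real (card (e \<inter> f))) - real l)
           \<le> real (card R)"
proof -
  have fin: "finite R" by (rule uniform_hypergraph_finite[OF R])
  have fe: "finite e" and ce: "card e = l"
    using uniform_hypergraph_finite_edge[OF R e] R e by (auto simp: uniform_hypergraph_def)
  let ?A = "edges_avoiding R e"
  have eA: "e \<notin> ?A" using ce l by (auto simp: edges_avoiding_def)
  have "(\<Sum>f\<in>R. real (card (e \<inter> f))) = real l + (\<Sum>f\<in>R - {e}. real (card (e \<inter> f)))"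
    using sum.remove[OF fin e, of "\<lambda>f. real (card (e \<inter> f))"] ce by simp
  also have "(\<Sum>f\<in>R - {e}. real (card (e \<inter> f))) \<le> (\<Sum>f\<in>R - {e}. if f \<in> ?A then 0 else 1)"
    using nd e by (intro sum_mono) (auto simp: edges_avoiding_def nearly_disjoint_def Int_commute)
  also have "\<dots> = real (card (R - {e} - ?A))"
    using fin by (subst sum.If_cases) (auto simp: Diff_eq)
  also have "card (R - {e} - ?A) = card R - 1 - card ?A"
    using fin e eA edges_avoiding_subset[of R e]
    by (subst card_Diff_subset) (auto intro: finite_edges_avoiding)
  finally have *: "(\<Sum>f\<in>R. real (card (e \<inter> f))) \<le> real l + real (card R - 1 - card ?A)"
    by simp
  have "card (insert e ?A) \<le> card R"
    using fin e edges_avoiding_subset[of R e] by (intro card_mono) auto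
  then have "card ?A + 1 \<le> card R" using eA finite_edges_avoiding[OF fin, of e] by simp
  with * show ?thesis by (simp add: of_nat_diff)
qed

section \<open>The factor gained per step and the inductive count of matchings\<close>

text \<open>Average weight of one choice when \<open>j\<close> edges remain to be chosen after it:
  the exceptional fraction \<open>p\<close> has weight 1, all other edges have weight
  \<open>exp (- (real j * \<eta>))\<close>.\<close>

definition step_factor :: "real \<Rightarrow> real \<Rightarrow> nat \<Rightarrow> real" where
  "step_factor p \<eta> j = p + (1 - p) * exp (- (real j * \<eta>))"

lemma step_factor_ge: "p \<le> 1 \<Longrightarrow> p \<le> step_factor p \<eta> j"
  by (simp add: step_factor_def)

lemma step_factor_pos: "0 < p \<Longrightarrow> p \<le> 1 \<Longrightarrow> 0 < step_factor p \<eta> j"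
  using step_factor_ge[of p \<eta> j] by linarith

lemma step_factor_antimono: "p \<le> 1 \<Longrightarrow> y \<le> real j * \<eta> \<Longrightarrow> step_factor p \<eta> j \<le> p + (1 - p) * exp (- y)"
  by (simp add: step_factor_def mult_left_mono)

lemma step_factor_le_1:
  assumes "0 \<le> p" "p \<le> 1" "0 \<le> \<eta>" shows "step_factor p \<eta> j \<le> 1"
  using step_factor_antimono[of p 0 j \<eta>] assms by simp

text \<open>The exponent is \<open>- s / t\<close> times the number of edges lost besides
  \<open>e\<close>. Outside an exceptional set of at most \<open>p * card R\<close> edges, this loss
  is at least \<open>\<eta> * t\<close>.\<close>

lemma sum_exp_edges_avoiding:
  fixes p t :: real
  assumes R: "uniform_hypergraph l V R" and nd: "nearly_disjoint R"
    and l: "l > 0" and n: "card V > 0" and p: "0 < p" "p \<le> 1" and t: "0 < t"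
    and deg: "12 \<le> p\<^sup>2 * (t * real l / real (card V))"
    and large: "p * t / 6 \<le> real (card R)"
  shows "(\<Sum>e\<in>R. exp (real s * (real (card (edges_avoiding R e)) + 1 - real (card R)) / t))
           \<le> real (card R) * step_factor p (p\<^sup>2 * real l ^ 2 / (12 * real (card V))) s"
proof -
  let ?n = "real (card V)" and ?x = "real (card R)"
  define \<eta> where "\<eta> = p\<^sup>2 * real l ^ 2 / (12 * ?n)"
  let ?g = "\<lambda>e. exp (real s * (real (card (edges_avoiding R e)) + 1 - ?x) / t)"
  let ?S = "\<lambda>e. \<Sum>f\<in>R. real (card (e \<inter> f))"
  define B where "B = {e \<in> R. ?S e < p * ?x * real l ^ 2 / ?n}"
  have fin: "finite R" by (rule uniform_hypergraph_finite[OF R])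
  have BR: "B \<subseteq> R" by (auto simp: B_def)
  have cB: "real (card B) \<le> p * ?x"
    unfolding B_def using p by (intro card_low_edges_le[OF R l n]) auto
  have mid: "p\<^sup>2 * t * real l ^ 2 / (6 * ?n) \<le> p * ?x * real l ^ 2 / ?n"
  proof -
    have "p * (p * t / 6) \<le> p * ?x" using large p by (intro mult_left_mono) auto
    then have "p * (p * t / 6) * real l ^ 2 / ?n \<le> p * ?x * real l ^ 2 / ?n"
      by (intro divide_right_mono mult_right_mono) auto
    then show ?thesis by (simp add: power2_eq_square mult_ac)
  qed
  \<comment> \<open>By \<open>deg\<close>, the correction \<open>l\<close> in the count of deleted
    edges is at most half of the lower bound on the degree sum. This halving turns the 6 of
    \<open>mid\<close> into the 12 in \<open>\<eta>\<close>.\<close>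
  have lo: "2 * real l \<le> p\<^sup>2 * t * real l ^ 2 / (6 * ?n)"
  proof -
    have "12 * real l \<le> p\<^sup>2 * (t * real l / ?n) * real l"
      using deg by (intro mult_right_mono) auto
    then show ?thesis by (simp add: power2_eq_square mult_ac)
  qed
  have good: "?g e \<le> exp (- (real s * \<eta>))" if e: "e \<in> R - B" for e
  proof -
    have "p * ?x * real l ^ 2 / ?n \<le> ?S e" using e by (auto simp: B_def)
    moreover have "real (card (edges_avoiding R e)) + 1 + (?S e - real l) \<le> ?x"
      using card_edges_avoiding[OF R nd l] e by auto
    moreover have "a + 1 - x \<le> - (Z / 2)"
      if "Y \<le> S" "a + 1 + (S - L) \<le> x" "Z \<le> Y" "2 * L \<le> Z" for a x S L Y Z :: real
      using that by linarith
    ultimately have "real (card (edges_avoiding R e)) + 1 - ?x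
        \<le> - (p\<^sup>2 * t * real l ^ 2 / (6 * ?n) / 2)"
      using mid lo by blast
    also have "\<dots> = - (\<eta> * t)" by (simp add: \<eta>_def)
    finally have "(real (card (edges_avoiding R e)) + 1 - ?x) / t \<le> - (\<eta> * t) / t"
      using t by (intro divide_right_mono) auto
    then have "(real (card (edges_avoiding R e)) + 1 - ?x) / t \<le> - \<eta>" using t by simp
    then have "real s * ((real (card (edges_avoiding R e)) + 1 - ?x) / t) \<le> real s * - \<eta>"
      by (intro mult_left_mono) auto
    then show ?thesis by simp
  qed
  \<comment> \<open>Here only the term \<open>f = e\<close> of the degree sum is kept: it already
    equals \<open>l\<close>, so the exponent is not positive.\<close>
  have bad: "?g e \<le> 1" if e: "e \<in> B" for e
  proof -
    have eR: "e \<in> R" using e BR by auto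
    have "real l = real (card (e \<inter> e))" using R eR by (auto simp: uniform_hypergraph_def)
    also have "\<dots> \<le> ?S e" using fin eR by (intro member_le_sum) auto
    finally have "real (card (edges_avoiding R e)) + 1 - ?x \<le> 0"
      using card_edges_avoiding[OF R nd l eR] by linarith
    then show ?thesis using t by (simp add: mult_nonneg_nonpos divide_nonpos_pos)
  qed
  define q where "q = exp (- (real s * \<eta>))"
  have q1: "q \<le> 1" by (simp add: q_def \<eta>_def)
  have "(\<Sum>e\<in>R. ?g e) = (\<Sum>e\<in>R - B. ?g e) + (\<Sum>e\<in>B. ?g e)"
    by (rule sum.subset_diff[OF BR fin])
  also have "\<dots> \<le> (\<Sum>e\<in>R - B. q) + (\<Sum>e\<in>B. 1)"
    unfolding q_def by (intro add_mono sum_mono good bad)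
  also have "\<dots> = (?x - real (card B)) * q + real (card B)"
    using BR fin by (simp add: card_Diff_subset finite_subset of_nat_diff card_mono)
  \<comment> \<open>The coefficient \<open>1 - q\<close> of \<open>card B\<close> is nonnegative, so
    the worst case is \<open>card B = p * card R\<close>.\<close>
  also have "\<dots> = ?x * q + real (card B) * (1 - q)" by (simp add: algebra_simps)
  also have "\<dots> \<le> ?x * q + p * ?x * (1 - q)"
    using cB q1 by (intro add_left_mono mult_right_mono) auto
  also have "\<dots> = ?x * step_factor p \<eta> s" by (simp add: step_factor_def q_def algebra_simps)
  finally show ?thesis by (simp add: \<eta>_def)
qed

text \<open>Here \<open>T\<close> is the maximal size allowed for \<open>R\<close> at this stage. A
  deficit \<open>T - card R\<close> is converted into an exponential gain by 1 + x <= exp x and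
  \<open>T \<le> t\<close>. If \<open>R\<close> is too small for the degree argument, its size alone
  gives the bound.\<close>

lemma sum_exp_edges_avoiding_le:
  fixes p t T :: real
  assumes R: "uniform_hypergraph l V R" and nd: "nearly_disjoint R"
    and l: "l > 0" and n: "card V > 0" and p: "0 < p" "p \<le> 1" and t: "0 < t"
    and deg: "12 \<le> p\<^sup>2 * (t * real l / real (card V))"
    and T: "t \<le> 2 * T" "T \<le> t" "real (card R) \<le> T"
  shows "(\<Sum>e\<in>R. exp (real s * (real (card (edges_avoiding R e)) + 1 - real (card R)) / t))
           \<le> T * exp (- ((T - real (card R)) / t)) *
              step_factor p (p\<^sup>2 * real l ^ 2 / (12 * real (card V))) s"
    (is "(\<Sum>e\<in>R. ?g e) \<le> T * ?E * ?q")
proof -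
  let ?x = "real (card R)"
  have q: "p \<le> ?q" using p step_factor_ge by blast
  have T0: "T > 0" using T t by linarith
  show ?thesis
  proof (cases "p * t / 6 \<le> ?x")
    case True
    have "(T - ?x) / t \<le> (T - ?x) / T" using T T0 by (intro divide_left_mono) auto
    then have "1 + - ((T - ?x) / T) \<le> ?E"
      using exp_ge_add_one_self[of "- ((T - ?x) / t)"] by linarith
    then have "T * (1 + - ((T - ?x) / T)) \<le> T * ?E" using T0 by (intro mult_left_mono) auto
    moreover have "T * (1 + - ((T - ?x) / T)) = ?x" using T0 by (simp add: field_simps)
    ultimately have "?x \<le> T * ?E" by simp
    then have "?x * ?q \<le> T * ?E * ?q" using q p by (intro mult_right_mono) auto
    with sum_exp_edges_avoiding[OF R nd l n p t deg True, of s] show ?thesis by linarith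
  next
    case False
    have fin: "finite R" by (rule uniform_hypergraph_finite[OF R])
    have "?g e \<le> 1" if e: "e \<in> R" for e
    proof -
      have "real l = real (card (e \<inter> e))" using R e by (auto simp: uniform_hypergraph_def)
      also have "\<dots> \<le> (\<Sum>f\<in>R. real (card (e \<inter> f)))" using fin e by (intro member_le_sum) auto
      finally have "real (card (edges_avoiding R e)) + 1 - ?x \<le> 0"
        using card_edges_avoiding[OF R nd l e] by linarith
      then show ?thesis using t by (simp add: mult_nonneg_nonpos divide_nonpos_pos)
    qed
    then have "(\<Sum>e\<in>R. ?g e) \<le> ?x" using sum_mono[of R ?g "\<lambda>_. 1"] by simp
    \<comment> \<open>The 6 in the threshold is chosen for this: \<open>t \<le> 2 * T\<close> leaves
      \<open>p * T / 3\<close>, where 1/3 is at most exp (-1) and \<open>p\<close> is at most the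
      step factor.\<close>
    also have "\<dots> \<le> p * (2 * T) / 6"
      using False T p mult_left_mono[of t "2 * T" p] by linarith
    also have "\<dots> = T * (1 / 3) * p" by simp
    also have "\<dots> \<le> T * ?E * ?q"
    proof (intro mult_mono q)
      have "(T - ?x) / t \<le> 1" using T t by (simp add: field_simps)
      then have "exp (-1) \<le> ?E" by simp
      moreover have "1 / 3 \<le> exp (-1 :: real)"
        using exp_le by (simp add: exp_minus field_simps)
      ultimately show "1 / 3 \<le> ?E" by linarith
    qed (use T0 p in auto)
    finally show ?thesis .
  qed
qed

text \<open>The factor \<open>exp (- s (T - |R|) / t)\<close> lets the induction collect the gain from every
  removed edge without tracking the sizes of the successive hypergraphs.\<close>

lemma card_matchings_le:
  fixes p t :: real
  assumes H: "uniform_hypergraph l V H" and nd: "nearly_disjoint H"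
    and l: "l > 0" and n: "card V > 0" and p: "0 < p" "p \<le> 1" and t: "0 < t"
    and deg: "12 \<le> p\<^sup>2 * (t * real l / real (card V))"
    and T0: "t \<le> 2 * real T0"
  shows "R \<subseteq> H \<Longrightarrow> card R \<le> T0 + s \<Longrightarrow> real (T0 + s) \<le> t \<Longrightarrow>
    real (card (matchings R s)) \<le> real ((T0 + s) choose s) *
      exp (- (real s * (real (T0 + s) - real (card R)) / t)) *
      (\<Prod>j<s. step_factor p (p\<^sup>2 * real l ^ 2 / (12 * real (card V))) j)"
proof (induction s arbitrary: R)
  case 0
  have "matchings R 0 \<subseteq> {{}}"
    using uniform_hypergraph_finite[OF uniform_hypergraph_subset[OF H \<open>R \<subseteq> H\<close>]]
    by (auto simp: matchings_def dest: finite_subset)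
  then have "card (matchings R 0) \<le> card {{} :: 'a set set}" by (intro card_mono) auto
  then show ?case by simp
next
  case (Suc s)
  define q where "q = step_factor p (p\<^sup>2 * real l ^ 2 / (12 * real (card V)))"
  define T where "T = real (T0 + Suc s)"
  let ?x = "real (card R)"
  have R: "uniform_hypergraph l V R" and ndR: "nearly_disjoint R"
    using uniform_hypergraph_subset[OF H] nearly_disjoint_subset[OF nd] Suc.prems by auto
  have fin: "finite R" by (rule uniform_hypergraph_finite[OF R])
  let ?C = "real ((T0 + s) choose s)" and ?P = "\<Prod>j<s. q j"
  have P0: "0 \<le> ?P"
    unfolding q_def using step_factor_pos[OF p] by (intro prod_nonneg) (simp add: less_imp_le)
  have IH: "real (card (matchings (edges_avoiding R e) s))
     \<le> ?C * ?P * exp (- (real s * (T - ?x) / t)) *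
        exp (real s * (real (card (edges_avoiding R e)) + 1 - ?x) / t)" if e: "e \<in> R" for e
  proof -
    have "card e = l" using R e by (auto simp: uniform_hypergraph_def)
    then have "edges_avoiding R e \<subseteq> R - {e}" using l by (auto simp: edges_avoiding_def)
    then have "card (edges_avoiding R e) \<le> card (R - {e})" using fin by (intro card_mono) auto
    then have c: "card (edges_avoiding R e) \<le> T0 + s" using Suc.prems e fin by simp
    have "real (card (matchings (edges_avoiding R e) s)) \<le> ?C *
      exp (- (real s * (real (T0 + s) - real (card (edges_avoiding R e))) / t)) * ?P"
      unfolding q_def using Suc.prems edges_avoiding_subset[of R e] c
      by (intro Suc.IH) auto
    \<comment> \<open>The allowed size drops by one together with \<open>e\<close>:
      \<open>T0 + s\<close> is \<open>T - 1\<close>, which produces the \<open>+ 1\<close> in the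
      exponent.\<close>
    also have "- (real s * (real (T0 + s) - real (card (edges_avoiding R e))) / t)
      = - (real s * (T - ?x) / t) + real s * (real (card (edges_avoiding R e)) + 1 - ?x) / t"
      by (simp add: T_def field_simps diff_divide_distrib add_divide_distrib)
    finally show ?thesis by (simp only: exp_add mult_ac)
  qed
  have "real (Suc s) * real (card (matchings R (Suc s)))
      \<le> real (\<Sum>e\<in>R. card (matchings (edges_avoiding R e) s))"
    using card_matchings_Suc[OF fin, of s] by (metis of_nat_le_iff of_nat_mult)
  also have "\<dots> \<le> (\<Sum>e\<in>R. ?C * ?P * exp (- (real s * (T - ?x) / t)) *
        exp (real s * (real (card (edges_avoiding R e)) + 1 - ?x) / t))"
    unfolding of_nat_sum by (intro sum_mono IH)
  also have "\<dots> = ?C * ?P * exp (- (real s * (T - ?x) / t)) *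
      (\<Sum>e\<in>R. exp (real s * (real (card (edges_avoiding R e)) + 1 - ?x) / t))"
    by (simp add: sum_distrib_left)
  also have "\<dots> \<le> ?C * ?P * exp (- (real s * (T - ?x) / t)) *
      (T * exp (- ((T - ?x) / t)) * q s)"
    unfolding q_def
  proof (intro mult_left_mono sum_exp_edges_avoiding_le[OF R ndR l n p t deg])
    show "t \<le> 2 * T" "T \<le> t" "?x \<le> T" using T0 Suc.prems by (auto simp: T_def)
  qed (use P0 in \<open>auto simp: q_def\<close>)
  also have "\<dots> = (T * ?C) * (exp (- (real s * (T - ?x) / t)) * exp (- ((T - ?x) / t))) * (?P * q s)"
    by (simp only: mult_ac)
  \<comment> \<open>Absorption identity for binomials; its factor \<open>Suc s\<close> cancels the
    one from the double counting.\<close>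
  also have "T * ?C = real (Suc s) * real ((T0 + Suc s) choose Suc s)"
    using Suc_times_binomial_eq[of "T0 + s" s] unfolding T_def
    by (metis add_Suc_right mult.commute of_nat_mult)
  also have "exp (- (real s * (T - ?x) / t)) * exp (- ((T - ?x) / t))
      = exp (- (real (Suc s) * (T - ?x) / t))"
    using t by (simp add: exp_add[symmetric] field_simps)
  also have "?P * q s = (\<Prod>j<Suc s. q j)" by simp
  finally have "real (Suc s) * real (card (matchings R (Suc s))) \<le> real (Suc s) *
     (real ((T0 + Suc s) choose Suc s) * exp (- (real (Suc s) * (T - ?x) / t)) * (\<Prod>j<Suc s. q j))"
    by (simp only: mult_ac)
  then show ?case
    unfolding T_def[symmetric] q_def[symmetric] by (subst (asm) mult_le_cancel_left_pos) auto
qed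

section \<open>From counts to probabilities\<close>

lemma matchings_size_le:
  assumes H: "uniform_hypergraph l V H" and M: "M \<in> matchings H m"
  shows "m * l \<le> card V"
proof -
  have dis: "disjoint M" and cM: "card M = m" and MH: "M \<subseteq> H" using M by (auto simp: matchings_def)
  have "m * l = (\<Sum>e\<in>M. card e)"
    using H MH cM by (subst sum.cong[of M M card "\<lambda>_. l"]) (auto simp: uniform_hypergraph_def)
  also have "\<dots> = card (\<Union>M)"
    using uniform_hypergraph_finite_edge[OF H] MH dis
    by (intro card_Union_disjoint[symmetric]) (auto simp: disjoint_def pairwise_def disjnt_def)
  also have "\<dots> \<le> card V" using H MH by (intro card_mono) (auto simp: uniform_hypergraph_def)
  finally show ?thesis .
qed

lemma prob_matching_le_prod:
  fixes p :: real
  assumes H: "uniform_hypergraph l V H" and nd: "nearly_disjoint H"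
    and l: "l > 0" and n: "card V > 0" and p: "0 < p" "p \<le> 1" and m: "m \<le> card H"
    and deg: "12 \<le> p\<^sup>2 * (real (card H) * real l / real (card V))"
  shows "measure_pmf.prob (random_subset m H) {M. is_matching M}
    \<le> (\<Prod>j<m. step_factor p (p\<^sup>2 * real l ^ 2 / (12 * real (card V))) j)"
    (is "_ \<le> ?P")
proof -
  let ?t = "card H" and ?S = "{M. M \<subseteq> H \<and> card M = m}"
  have fin: "finite H" by (rule uniform_hypergraph_finite[OF H])
  have P0: "0 \<le> ?P"
    using step_factor_pos[OF p] by (intro prod_nonneg) (simp add: less_imp_le)
  have t: "0 < ?t" using deg by (auto intro!: gr0I)
  have cS: "card ?S = ?t choose m" by (rule n_subsets[OF fin])
  have pos: "0 < ?t choose m" using m by (rule zero_less_binomial)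
  have S: "finite ?S" "?S \<noteq> {}" using cS pos by (auto intro: card_ge_0_finite simp del: Collect_empty_eq)
  have "?S \<inter> {M. is_matching M} = matchings H m"
    by (auto simp: matchings_def is_matching_def)
  then have prob: "measure_pmf.prob (random_subset m H) {M. is_matching M}
      = real (card (matchings H m)) / real (?t choose m)"
    unfolding random_subset_def using S by (simp add: measure_pmf_of_set cS)
  show ?thesis
  proof (cases "matchings H m = {}")
    case True
    show ?thesis unfolding prob True using P0 by simp
  next
    case False
    \<comment> \<open>An existing matching occupies \<open>m * l\<close> vertices, so
      \<open>deg\<close> forces \<open>12 * m\<close> to be at most \<open>card H\<close>. Hence
      \<open>T0 = card H - m\<close> is at least half of \<open>card H\<close>, as the induction
      requires.\<close>
    then have "m * l \<le> card V" using matchings_size_le[OF H] by blast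
    then have ml: "real m * real l \<le> real (card V)" by (metis of_nat_le_iff of_nat_mult)
    have "p\<^sup>2 \<le> 1" using p by (simp add: power_le_one)
    then have "p\<^sup>2 * (real ?t * real l / real (card V)) \<le> 1 * (real ?t * real l / real (card V))"
      by (intro mult_right_mono) auto
    with deg have "12 * real (card V) \<le> real ?t * real l"
      using n by (simp add: field_simps)
    with ml have "(12 * real m) * real l \<le> real ?t * real l" by simp
    then have "12 * real m \<le> real ?t" using l by simp
    then have "real ?t \<le> 2 * real (?t - m)" using m by (simp add: of_nat_diff)
    \<comment> \<open>For \<open>R = H\<close> and this \<open>T0\<close> the deficit is zero, so
      the exponential is 1, and the binomial is exactly the number of \<open>m\<close>-subsets of
      \<open>H\<close>.\<close>
    then have "real (card (matchings H m)) \<le> real ((?t - m + m) choose m) *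
      exp (- (real m * (real (?t - m + m) - real (card H)) / real ?t)) * ?P"
      using t m by (intro card_matchings_le[OF H nd l n p _ deg]) auto
    then have "real (card (matchings H m)) \<le> real (?t choose m) * ?P" using m by simp
    then show ?thesis unfolding prob using pos by (simp add: field_simps)
  qed
qed

text \<open>Only the second half of the factors is used: there \<open>j \<ge> m / 2\<close>.\<close>

lemma prob_matching_le_power:
  fixes p :: real
  assumes H: "uniform_hypergraph l V H" and nd: "nearly_disjoint H"
    and l: "l > 0" and n: "card V > 0" and p: "0 < p" "p \<le> 1" and m: "m \<le> card H"
    and deg: "12 \<le> p\<^sup>2 * (real (card H) * real l / real (card V))"
    and y: "y \<le> p\<^sup>2 * (real m * real l ^ 2 / real (card V)) / 24"
  shows "measure_pmf.prob (random_subset m H) {M. is_matching M}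
    \<le> (p + (1 - p) * exp (- y)) ^ (m div 2)"
proof -
  define \<eta> where "\<eta> = p\<^sup>2 * real l ^ 2 / (12 * real (card V))"
  \<comment> \<open>Rounding \<open>?a\<close> up ensures \<open>m \<le> 2 * j\<close> for every
    \<open>j \<ge> ?a\<close>, also for odd \<open>m\<close>, and leaves exactly
    \<open>m div 2\<close> factors.\<close>
  let ?q = "step_factor p \<eta>" and ?r = "p + (1 - p) * exp (- y)" and ?a = "m - m div 2"
  have "?q j \<le> (if j < ?a then 1 else ?r)" for j
  proof (cases "j < ?a")
    case True
    then show ?thesis using step_factor_le_1[of p \<eta> j] p by (simp add: \<eta>_def)
  next
    case False
    then have "m \<le> 2 * j" by linarith
    then have "real m / 2 * \<eta> \<le> real j * \<eta>" by (intro mult_right_mono) (auto simp: \<eta>_def)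
    moreover have "real m / 2 * \<eta> = p\<^sup>2 * (real m * real l ^ 2 / real (card V)) / 24"
      by (simp add: \<eta>_def mult_ac)
    ultimately have "y \<le> real j * \<eta>" using y by linarith
    with False step_factor_antimono[OF p(2)] show ?thesis by auto
  qed
  then have "(\<Prod>j<m. ?q j) \<le> (\<Prod>j<m. if j < ?a then 1 else ?r)"
    using step_factor_pos[OF p] by (intro prod_mono) (simp add: less_imp_le)
  also have "\<dots> = ?r ^ card ({..<m} \<inter> - {..<?a})"
    by (simp add: prod.If_cases lessThan_def)
  also have "{..<m} \<inter> - {..<?a} = {?a..<m}" by auto
  also have "card {?a..<m} = m div 2" by simp
  finally show ?thesis
    using prob_matching_le_prod[OF H nd l n p m deg] unfolding \<eta>_def by linarith
qed

section \<open>Choice of p for bounded and for large c\<close>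

lemma half_plus_half_exp_le:
  fixes z :: real
  assumes "0 \<le> z" "z \<le> 1"
  shows "1 / 2 + 1 / 2 * exp (- z) \<le> exp (- (z / 4))"
proof -
  have "exp (- z) \<le> 1 / (1 + z)"
    using assms exp_ge_add_one_self[of z] by (simp add: exp_minus field_simps)
  also have "\<dots> \<le> 1 - z / 2"
  proof -
    have "z * z \<le> z * 1" using assms by (intro mult_left_mono) auto
    then show ?thesis using assms by (simp add: field_simps)
  qed
  finally have "1 / 2 + 1 / 2 * exp (- z) \<le> 1 + - (z / 4)" by simp
  also have "\<dots> \<le> exp (- (z / 4))" by (rule exp_ge_add_one_self)
  finally show ?thesis .
qed

text \<open>The constant 3 is attained at \<open>m = 3\<close>, where
  \<open>m div 2 = 1\<close>.\<close>

lemma exp_power_div2_le: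
  fixes w :: real
  assumes "0 \<le> w" "2 \<le> m"
  shows "exp (- w) ^ (m div 2) \<le> exp (- (w * real m / 3))"
proof -
  have "m \<le> 3 * (m div 2)" using assms by linarith
  then have "real m \<le> 3 * real (m div 2)" by linarith
  then have "w * (real m / 3) \<le> w * real (m div 2)" using assms by (intro mult_left_mono) auto
  then show ?thesis by (simp add: exp_of_nat_mult[symmetric] mult_ac)
qed

lemma prob_matching_small:
  fixes c :: real
  assumes H: "uniform_hypergraph l V H" and nd: "nearly_disjoint H"
    and l: "l > 0" and n: "card V > 0" and m: "2 \<le> m" "m \<le> card H"
    and deg: "144 \<le> real (card H) * real l / real (card V)"
    and c: "0 \<le> c" "c \<le> 10000" "c \<le> real m * real l ^ 2 / real (card V)"
  shows "measure_pmf.prob (random_subset m H) {M. is_matching M} \<le> exp (- (c * real m / 120000))"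
proof -
  \<comment> \<open>This value is at most 1, as the convexity estimate needs, and at most
    \<open>c / 96\<close>, the exponent available for \<open>p = 1/2\<close>. The final 120000 is
    10000 * 4 * 3.\<close>
  let ?z = "c / 10000"
  have "?z \<le> (1 / 2)\<^sup>2 * X / 24" if "c \<le> X" for X
    using that c by (simp add: power2_eq_square)
  then have z: "?z \<le> (1 / 2)\<^sup>2 * (real m * real l ^ 2 / real (card V)) / 24"
    using c by blast
  have "measure_pmf.prob (random_subset m H) {M. is_matching M}
      \<le> (1 / 2 + (1 - 1 / 2) * exp (- ?z)) ^ (m div 2)"
    using deg by (intro prob_matching_le_power[OF H nd l n _ _ m(2) _ z]) (auto simp: power2_eq_square)
  also have "\<dots> \<le> exp (- (?z / 4)) ^ (m div 2)"
    using half_plus_half_exp_le[of ?z] c by (intro power_mono) (auto intro: add_nonneg_nonneg)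
  also have "\<dots> \<le> exp (- (?z / 4 * real m / 3))"
    using c m by (intro exp_power_div2_le) auto
  finally show ?thesis by simp
qed

lemma prob_matching_large:
  fixes c :: real
  assumes H: "uniform_hypergraph l V H" and nd: "nearly_disjoint H"
    and l: "l > 0" and n: "card V > 0" and m: "2 \<le> m" "m \<le> card H"
    and c: "10000 \<le> c" "c \<le> real m * real l ^ 2 / real (card V)"
      "c \<le> real (card H) * real l / real (card V)"
  shows "measure_pmf.prob (random_subset m H) {M. is_matching M} \<le> exp (- (ln c * real m / 24))"
proof -
  \<comment> \<open>This is \<open>c\<close> to the power -1/4. It makes \<open>p^2 * c\<close>
    equal to \<open>sqrt c\<close>, large enough both for the degree condition and for the
    non-exceptional term to fall below \<open>p\<close>.\<close>
  define p where "p = exp (- (ln c / 4))"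
  have c0: "c > 0" using c by simp
  have p2: "p\<^sup>2 * c = sqrt c"
  proof -
    have "p\<^sup>2 * c = exp (- (ln c / 2)) * exp (ln c)"
      using c0 by (simp add: p_def power2_eq_square exp_add[symmetric])
    also have "\<dots> = exp (ln c / 2)" by (simp add: exp_add[symmetric])
    also have "\<dots> = exp (ln (sqrt c))" using c0 by (simp add: ln_sqrt)
    also have "\<dots> = sqrt c" using c0 by simp
    finally show ?thesis .
  qed
  have s100: "100 \<le> sqrt c" using real_sqrt_le_mono[OF c(1)] by simp
  have p: "0 < p" "p \<le> 1" using c by (auto simp: p_def)
  have ln_s: "ln (sqrt c) = ln c / 2" using c0 by (simp add: ln_sqrt)
  \<comment> \<open>The tangent of ln at 25 gives \<open>ln c / 4 \<le> sqrt c / 24\<close> once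
    \<open>sqrt c\<close> is at least 100, that is,
    \<open>exp (- (sqrt c / 24)) \<le> p\<close>.\<close>
  have "ln (sqrt c / 25) \<le> sqrt c / 25 - 1" using c0 by (intro ln_le_minus_one) simp
  moreover have "ln (sqrt c / 25) = ln c / 2 - ln 25" using c0 ln_s by (simp add: ln_div)
  moreover have "ln 25 \<le> (4 :: real)"
  proof -
    have "(25 :: real) \<le> (5 / 2) ^ 4" by (simp add: power4_eq_xxxx)
    also have "\<dots> \<le> exp 1 ^ 4"
      using exp_lower_Taylor_quadratic[of "1 :: real"] by (intro power_mono) auto
    also have "\<dots> = exp 4" by (simp add: exp_of_nat_mult[symmetric])
    finally have "ln 25 \<le> ln (exp (4 :: real))" by (subst ln_le_cancel_iff) auto
    then show ?thesis by simp
  qed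
  ultimately have lnc: "ln c / 4 \<le> sqrt c / 24" using s100 by linarith
  \<comment> \<open>The base of the power will be at most \<open>2 * p\<close>; half of the exponent
    \<open>ln c / 4\<close> is given up to absorb this 2.\<close>
  have "2 ^ 8 \<le> c" using c by simp
  then have "ln (2 ^ 8) \<le> ln c" using c0 by (subst ln_le_cancel_iff) auto
  moreover have "ln (2 ^ 8) = 8 * ln (2 :: real)" by (subst ln_realpow) auto
  ultimately have "8 * ln 2 \<le> ln c" by linarith
  then have l2: "ln 2 \<le> ln c / 8" by simp
  have deg: "12 \<le> p\<^sup>2 * (real (card H) * real l / real (card V))"
    using mult_left_mono[OF c(3), of "p\<^sup>2"] p2 s100 by simp
  have "sqrt c / 24 \<le> p\<^sup>2 * (real m * real l ^ 2 / real (card V)) / 24"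
    using mult_left_mono[OF c(2), of "p\<^sup>2"] p2 by simp
  then have "measure_pmf.prob (random_subset m H) {M. is_matching M}
      \<le> (p + (1 - p) * exp (- (sqrt c / 24))) ^ (m div 2)"
    by (rule prob_matching_le_power[OF H nd l n p m(2) deg])
  also have "\<dots> \<le> exp (- (ln c / 8)) ^ (m div 2)"
  proof (intro power_mono)
    have "(1 - p) * exp (- (sqrt c / 24)) \<le> 1 * exp (- (ln c / 4))"
      using p lnc by (intro mult_mono) auto
    then have "p + (1 - p) * exp (- (sqrt c / 24)) \<le> 2 * p" by (simp add: p_def)
    also have "\<dots> = exp (ln 2) * exp (- (ln c / 4))" by (simp add: p_def)
    also have "\<dots> \<le> exp (- (ln c / 8))" using l2 by (simp only: exp_add[symmetric] exp_le_cancel_iff)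
    finally show "p + (1 - p) * exp (- (sqrt c / 24)) \<le> exp (- (ln c / 8))" .
    show "0 \<le> p + (1 - p) * exp (- (sqrt c / 24))" using p by simp
  qed
  also have "\<dots> \<le> exp (- (ln c / 8 * real m / 3))"
    using c m by (intro exp_power_div2_le) auto
  finally show ?thesis by simp
qed

text \<open>The proof splits at 10000 instead of e: between the two, \<open>ln c \<le> c\<close>
  lets the linear bound cover the logarithmic one. The constant is half of 1/120000, which makes the
  inequality strict.\<close>

lemma prob_matching_less:
  fixes c :: real
  assumes H: "uniform_hypergraph l V H" and nd: "nearly_disjoint H"
    and l: "l > 0" and n: "card V > 0" and m: "2 \<le> m" "m \<le> card H"
    and deg: "144 \<le> real (card H) * real l / real (card V)"
    and c: "c = min (real m * real l ^ 2 / real (card V)) (real (card H) * real l / real (card V))"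
  shows "measure_pmf.prob (random_subset m H) {M. is_matching M}
    < (if c \<le> exp 1 then exp (- (1 / 240000 * (c * real m))) else exp (- (1 / 240000 * (ln c * real m))))"
    (is "?prob < _")
proof -
  have c0: "0 < c" using c l n m deg by auto
  have lnc: "ln c \<le> c" using ln_le_minus_one[OF c0] by simp
  show ?thesis
  proof (cases "c \<le> 10000")
    case True
    then have le: "?prob \<le> exp (- (c * real m / 120000))"
      using c c0 by (intro prob_matching_small[OF H nd l n m deg]) auto
    have "0 < c * real m" using c0 m by simp
    moreover have "ln c * real m < 2 * (c * real m)"
      using mult_right_mono[OF lnc, of "real m"] calculation by linarith
    ultimately show ?thesis
      by (auto intro!: order.strict_trans1[OF le] simp: mult_ac)
  next
    case False
    then have le: "?prob \<le> exp (- (ln c * real m / 24))"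
      using c by (intro prob_matching_large[OF H nd l n m]) auto
    have "exp 1 \<le> (3 :: real)" by (rule exp_le)
    then have "\<not> c \<le> exp 1" using False by linarith
    moreover have "0 < ln c * real m" using False m by simp
    ultimately show ?thesis by (auto intro!: order.strict_trans1[OF le] simp: mult_ac)
  qed
qed

text \<open>The constant precedes the sequences, so it is absolute. For \<open>m\<close> at most 1
  every chosen family is a matching and the strict bound fails, hence
  \<open>2 \<le> m k\<close>.\<close>

theorem theorem1p6:
  "\<exists>\<delta>::real. \<delta> > 0 \<and>
     (\<forall>(V :: nat \<Rightarrow> 'a set) (H :: nat \<Rightarrow> 'a set set)
       (n :: nat \<Rightarrow> nat) (l :: nat \<Rightarrow> nat) (t :: nat \<Rightarrow> nat) (m :: nat \<Rightarrow> nat).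
        (\<forall>k. uniform_hypergraph (l k) (V k) (H k) \<and> nearly_disjoint (H k) \<and>
             card (V k) = n k \<and> card (H k) = t k \<and> 2 \<le> m k \<and> m k \<le> t k) \<longrightarrow>
        filterlim n at_top sequentially \<longrightarrow>
        (\<lambda>k. real (n k) / real (l k)) \<in> o(\<lambda>k. real (t k)) \<longrightarrow>
        (\<forall>\<^sub>F k in sequentially.
           let c = min (real (m k) * real (l k) ^ 2 / real (n k))
                       (real (t k) * real (l k) / real (n k))
           in measure_pmf.prob (random_subset (m k) (H k)) {M. is_matching M}
                < (if c \<le> exp 1 then exp (- (\<delta> * (c * real (m k))))
                   else exp (- (\<delta> * (ln c * real (m k)))))))"
proof (intro exI[of _ "1 / 240000"] conjI allI impI)
  fix V :: "nat \<Rightarrow> 'a set" and H :: "nat \<Rightarrow> 'a set set" and n l t m :: "nat \<Rightarrow> nat"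
  assume hyp: "\<forall>k. uniform_hypergraph (l k) (V k) (H k) \<and> nearly_disjoint (H k) \<and>
             card (V k) = n k \<and> card (H k) = t k \<and> 2 \<le> m k \<and> m k \<le> t k"
    and lim: "filterlim n at_top sequentially"
    and small: "(\<lambda>k. real (n k) / real (l k)) \<in> o(\<lambda>k. real (t k))"
  have ev1: "\<forall>\<^sub>F k in sequentially. 1 \<le> n k"
    using lim by (simp add: filterlim_at_top)
  \<comment> \<open>The constant 1/144 yields \<open>t * l / n \<ge> 144\<close>; for
    \<open>p = 1/2\<close> this makes \<open>p^2 * t * l / n\<close> at least 36, above the required
    12.\<close>
  have ev2: "\<forall>\<^sub>F k in sequentially. norm (real (n k) / real (l k)) \<le> 1 / 144 * norm (real (t k))"
    using small by (rule landau_o.smallD) simp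
  show "\<forall>\<^sub>F k in sequentially.
           let c = min (real (m k) * real (l k) ^ 2 / real (n k))
                       (real (t k) * real (l k) / real (n k))
           in measure_pmf.prob (random_subset (m k) (H k)) {M. is_matching M}
                < (if c \<le> exp 1 then exp (- (1 / 240000 * (c * real (m k))))
                   else exp (- (1 / 240000 * (ln c * real (m k)))))"
    using ev1 ev2
  proof eventually_elim
    case (elim k)
    have H: "uniform_hypergraph (l k) (V k) (H k)" and nd: "nearly_disjoint (H k)"
      and nk: "n k = card (V k)" and tk: "t k = card (H k)" and m: "2 \<le> m k" "m k \<le> card (H k)"
      using hyp by auto
    \<comment> \<open>Since division by zero gives 0, the asymptotic hypothesis does not exclude
      \<open>l k = 0\<close>. But then the empty set is the only possible edge, against
      \<open>2 \<le> m k \<le> t k\<close>.\<close>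
    have l: "l k > 0"
    proof (rule ccontr)
      assume "\<not> l k > 0"
      then have "H k \<subseteq> {{}}"
        using H uniform_hypergraph_finite_edge[OF H] by (fastforce simp: uniform_hypergraph_def)
      then have "card (H k) \<le> card {{} :: 'a set}" by (intro card_mono) auto
      with m show False by simp
    qed
    have n: "card (V k) > 0" using elim nk by simp
    have "144 \<le> real (card (H k)) * real (l k) / real (card (V k))"
      using elim(2) l n by (simp add: nk tk field_simps)
    from prob_matching_less[OF H nd l n m this refl] show ?case
      unfolding Let_def nk tk .
  qed
qed simp

end
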